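(* Let $L>0$ and $T>0$, let $\eta=\eta(t,x)$ be a smooth real-valued function on $[0,T]\times\mathbb{R}$, $L$-periodic in $x$, and let $u=u(t,x)$ be a smooth real-valued function on $[0,T]\times\mathbb{R}$, $L$-periodic in $x$, with zero spatial average ($\int_0^Lu(t,x)\,dx=0$ for all $t$), solving $$\partial_t u+u\,\partial_x u=\eta .$$ Then, for every $h\in\mathbb{R}$ (and every $t\in[0,T]$), $$\partial_t\left(\frac12\int_0^L|D^hu|\,D^hu\,dx\right)+\partial_h\,\frac16\int_0^L|D^hu|^3\,dx=\int_0^L D^h\eta\,|D^hu|\,dx .$$
   Context: $D^h$ denotes the finite-difference operator in $x$: $D^hu(t,x)=u(t,x+h)-u(t,x)$. *)

theory Defs
  imports "HOL-Analysis.Analysis"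
begin

text \<open>
  Differentiability is taken relative to \<open>S\<close>, hence one-sided at boundary points of \<open>S\<close>. The
  derivatives are uniquely determined by \<open>f\<close> when \<open>S\<close> is, for example, a convex set with nonempty
  interior, such as \<open>{0..T} \<times> UNIV\<close> with \<open>T > 0\<close>.
\<close>

primrec Ck_on :: "nat \<Rightarrow> 'a set \<Rightarrow> ('a::euclidean_space \<Rightarrow> 'b::real_normed_vector) \<Rightarrow> bool"
  where
    "Ck_on 0 S f \<longleftrightarrow> continuous_on S f"
  | "Ck_on (Suc k) S f \<longleftrightarrow>
       (\<exists>f'. (\<forall>p\<in>S. (f has_derivative f' p) (at p within S)) \<and> (\<forall>v. Ck_on k S (\<lambda>p. f' p v)))"

definition smooth_on :: "'a set \<Rightarrow> ('a::euclidean_space \<Rightarrow> 'b::real_normed_vector) \<Rightarrow> bool"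
  where "smooth_on S f \<longleftrightarrow> (\<forall>k. Ck_on k S f)"

definition diff_x :: "real \<Rightarrow> (real \<Rightarrow> real \<Rightarrow> real) \<Rightarrow> real \<Rightarrow> real \<Rightarrow> real"
  where "diff_x h u t x = u t (x + h) - u t x"

end

theory Submission
  imports Defs
begin

text \<open>
  Write \<open>v(x) = u(t, x + h)\<close> and \<open>w = v - u = D\<^sup>h u\<close>. The functions \<open>w \<mapsto> \<bar>w\<bar> w\<close> and \<open>w \<mapsto> \<bar>w\<bar>\<^sup>3\<close> are
  continuously differentiable, with derivatives \<open>2 \<bar>w\<bar>\<close> and \<open>3 \<bar>w\<bar> w\<close>, so both integrals may be
  differentiated under the integral sign. As \<open>\<partial>\<^sub>t w = D\<^sup>h \<eta> - (v v\<^sub>x - u u\<^sub>x)\<close> by the equation, and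
  \<open>\<partial>\<^sub>h w = v\<^sub>x\<close>, the sum of the two derivatives is
  \<open>\<integral> \<bar>w\<bar> D\<^sup>h \<eta> - \<integral> (\<bar>w\<bar> (v v\<^sub>x - u u\<^sub>x) - \<bar>w\<bar> w v\<^sub>x / 2)\<close>.
  The last integrand is the exact derivative \<open>\<partial>\<^sub>x (\<bar>w\<bar>\<^sup>3 / 6 + u \<bar>w\<bar> w / 2)\<close> of a periodic function,
  hence integrates to zero over a period (lemma \<open>increment_flux_integral_zero\<close>).
\<close>

lemma DERIV_abs_mult_self:
  fixes x :: real
  shows "((\<lambda>y. \<bar>y\<bar> * y) has_real_derivative 2 * \<bar>x\<bar>) (at x)"
proof (cases x "0::real" rule: linorder_cases)
  case less
  have "((\<lambda>y. - (y * y)) has_real_derivative 2 * \<bar>x\<bar>) (at x)"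
    using less by (auto intro!: derivative_eq_intros)
  then show ?thesis
    by (rule has_field_derivative_transform_within_open[of _ _ _ "{..<0}"]) (use less in auto)
next
  case equal
  have "((\<lambda>y. \<bar>y\<bar>) \<longlongrightarrow> \<bar>0::real\<bar>) (at 0)"
    by (intro tendsto_intros)
  then have "((\<lambda>y::real. (\<bar>y\<bar> * y - \<bar>0\<bar> * 0) / (y - 0)) \<longlongrightarrow> 0) (at 0)"
    by (rule Lim_transform_within[where d = 1, THEN tendsto_eq_rhs]) auto
  then show ?thesis
    using equal by (simp add: has_field_derivative_iff)
next
  case greater
  have "((\<lambda>y. y * y) has_real_derivative 2 * \<bar>x\<bar>) (at x)"
    using greater by (auto intro!: derivative_eq_intros)
  then show ?thesis
    by (rule has_field_derivative_transform_within_open[of _ _ _ "{0<..}"]) (use greater in auto)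
qed

text \<open>
  This form reduces the derivative of \<open>\<bar>y\<bar>\<^sup>3\<close>, including at \<open>0\<close>, to that of \<open>\<bar>y\<bar> y\<close> by the product rule.
\<close>

lemma abs_power3_eq: "\<bar>y\<bar> ^ 3 = \<bar>y\<bar> * y * y" for y :: real
  by (simp add: power3_eq_cube abs_if)

lemma DERIV_abs_power3:
  fixes x :: real
  shows "((\<lambda>y. \<bar>y\<bar> ^ 3) has_real_derivative 3 * (\<bar>x\<bar> * x)) (at x)"
  unfolding abs_power3_eq
  by (rule DERIV_mult[OF DERIV_abs_mult_self DERIV_ident, THEN DERIV_cong]) simp

text \<open>
  The derivative along the second coordinate is the Frechet derivative applied to \<open>(0, 1)\<close>; it is
  two-sided since the slices of \<open>A \<times> UNIV\<close> are whole lines.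
\<close>

lemma smooth_on_continuous_partial_snd:
  fixes f :: "real \<Rightarrow> real \<Rightarrow> real"
  assumes "smooth_on (A \<times> UNIV) (\<lambda>(t, x). f t x)"
  obtains g where "continuous_on (A \<times> UNIV) (\<lambda>(t, x). g t x)"
    and "\<And>t x. t \<in> A \<Longrightarrow> (f t has_real_derivative g t x) (at x)"
proof -
  have "Ck_on (Suc 0) (A \<times> UNIV) (\<lambda>(t, x). f t x)"
    using assms unfolding smooth_on_def by blast
  then obtain F where
    F: "\<And>p. p \<in> A \<times> UNIV \<Longrightarrow> ((\<lambda>(t, x). f t x) has_derivative F p) (at p within A \<times> UNIV)"
    and cont: "\<And>v. continuous_on (A \<times> UNIV) (\<lambda>p. F p v)"
    by auto
  show thesis
  proof
    show "continuous_on (A \<times> UNIV) (\<lambda>(t, x). F (t, x) (0, 1))"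
      using cont[of "(0, 1)"] by (simp add: case_prod_beta)
  next
    fix t x :: real
    assume t: "t \<in> A"
    have line: "((\<lambda>y. (t, y)) has_derivative (\<lambda>d. (0, d))) (at x)"
      by (auto intro!: derivative_eq_intros)
    have "((\<lambda>(t, x). f t x) has_derivative F (t, x)) (at (t, x) within range (\<lambda>y. (t, y)))"
      by (rule has_derivative_subset[OF F]) (use t in auto)
    from has_derivative_in_compose[OF line this]
    have "(f t has_derivative (\<lambda>d. F (t, x) (0, d))) (at x)"
      by simp
    moreover have "(\<lambda>d. F (t, x) (0, d)) = (*) (F (t, x) (0, 1))"
    proof
      fix d :: real
      show "F (t, x) (0, d) = F (t, x) (0, 1) * d"
        using linear_scale[OF has_derivative_linear[OF F], of "(t, x)" d "(0, 1)"] t by simp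
    qed
    ultimately show "(f t has_real_derivative F (t, x) (0, 1)) (at x)"
      unfolding has_field_derivative_def by simp
  qed
qed

text \<open>
  The integrand is the derivative of the periodic function \<open>\<bar>w\<bar>\<^sup>3 / 6 + f \<bar>w\<bar> w / 2\<close> for the
  increment \<open>w = f (x + h) - f x\<close>.
\<close>

lemma increment_flux_integral_zero:
  fixes f f' :: "real \<Rightarrow> real"
  assumes L: "L \<ge> 0" and per: "\<And>x. f (x + L) = f x"
    and f': "\<And>x. (f has_real_derivative f' x) (at x)"
  shows "((\<lambda>x. \<bar>f (x + h) - f x\<bar> * (f (x + h) * f' (x + h) - f x * f' x)
             - 1/2 * (\<bar>f (x + h) - f x\<bar> * (f (x + h) - f x)) * f' (x + h)) has_integral 0) {0..L}"
proof -
  define w where "w x = f (x + h) - f x" for x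
  define F where "F x = 1/6 * \<bar>w x\<bar> ^ 3 + 1/2 * f x * (\<bar>w x\<bar> * w x)" for x
  have w': "(w has_real_derivative f' (x + h) - f' x) (at x)" for x
    unfolding w_def[abs_def] using f'[of "x + h"] f'[of x]
    by (intro DERIV_diff) (simp_all add: DERIV_shift)
  have "(F has_real_derivative
      \<bar>w x\<bar> * (f (x + h) * f' (x + h) - f x * f' x) - 1/2 * (\<bar>w x\<bar> * w x) * f' (x + h)) (at x)" for x
    unfolding F_def[abs_def]
    by (rule DERIV_add[OF DERIV_cmult[OF DERIV_chain2[OF DERIV_abs_power3 w']]
          DERIV_mult[OF DERIV_cmult[OF f'] DERIV_chain2[OF DERIV_abs_mult_self w']], THEN DERIV_cong])
      (simp add: w_def field_simps)
  then have "((\<lambda>x. \<bar>w x\<bar> * (f (x + h) * f' (x + h) - f x * f' x)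
      - 1/2 * (\<bar>w x\<bar> * w x) * f' (x + h)) has_integral (F L - F 0)) {0..L}"
    using L by (intro fundamental_theorem_of_calculus)
      (auto intro: has_field_derivative_at_within
        simp flip: has_real_derivative_iff_has_vector_derivative)
  moreover have "F L = F 0"
    using per[of 0] per[of h] by (simp add: F_def w_def add.commute)
  ultimately show ?thesis
    by (simp add: w_def)
qed

theorem lemma2p4:
  fixes L T :: real and u \<eta> :: "real \<Rightarrow> real \<Rightarrow> real"
  assumes "L > 0" and "T > 0"
    and "smooth_on ({0..T} \<times> UNIV) (\<lambda>(t, x). \<eta> t x)"
    and "\<forall>t\<in>{0..T}. \<forall>x. \<eta> t (x + L) = \<eta> t x"
    and "smooth_on ({0..T} \<times> UNIV) (\<lambda>(t, x). u t x)"
    and "\<forall>t\<in>{0..T}. \<forall>x. u t (x + L) = u t x"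
    and "\<forall>t\<in>{0..T}. integral {0..L} (\<lambda>x. u t x) = 0"
    and "\<forall>t\<in>{0..T}. \<forall>x. \<exists>u\<^sub>t u\<^sub>x.
           ((\<lambda>s. u s x) has_real_derivative u\<^sub>t) (at t within {0..T}) \<and>
           ((\<lambda>y. u t y) has_real_derivative u\<^sub>x) (at x) \<and>
           u\<^sub>t + u t x * u\<^sub>x = \<eta> t x"
  shows "\<forall>h. \<forall>t\<in>{0..T}. \<exists>a b.
           ((\<lambda>s. 1/2 * integral {0..L} (\<lambda>x. \<bar>diff_x h u s x\<bar> * diff_x h u s x))
              has_real_derivative a) (at t within {0..T}) \<and>
           ((\<lambda>k. 1/6 * integral {0..L} (\<lambda>x. \<bar>diff_x k u t x\<bar> ^ 3))
              has_real_derivative b) (at h) \<and>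
           a + b = integral {0..L} (\<lambda>x. diff_x h \<eta> t x * \<bar>diff_x h u t x\<bar>)"
proof (intro allI ballI)
  fix h t
  assume t: "t \<in> {0..T}"
  obtain ux where ux_cont: "continuous_on ({0..T} \<times> UNIV) (\<lambda>(t, x). ux t x)"
    and ux: "\<And>t x. t \<in> {0..T} \<Longrightarrow> (u t has_real_derivative ux t x) (at x)"
    using smooth_on_continuous_partial_snd[OF assms(5)] by blast
  have "Ck_on 0 ({0..T} \<times> UNIV) (\<lambda>(t, x). u t x)" "Ck_on 0 ({0..T} \<times> UNIV) (\<lambda>(t, x). \<eta> t x)"
    using assms(3,5) unfolding smooth_on_def by blast+
  then have u_cont: "continuous_on ({0..T} \<times> UNIV) (\<lambda>(t, x). u t x)"
    and \<eta>_cont: "continuous_on ({0..T} \<times> UNIV) (\<lambda>(t, x). \<eta> t x)"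
    by simp_all
  \<comment> \<open>Reading the time derivative off the equation makes its continuity evident.\<close>
  define ut where "ut s x = \<eta> s x - u s x * ux s x" for s x
  have ut: "((\<lambda>s. u s x) has_real_derivative ut s x) (at s within {0..T})"
    if s: "s \<in> {0..T}" for s x
  proof -
    from assms(8) s obtain a b
      where a: "((\<lambda>s. u s x) has_real_derivative a) (at s within {0..T})"
        and b: "(u s has_real_derivative b) (at x)" and eq: "a + u s x * b = \<eta> s x"
      by blast
    have "b = ux s x"
      using DERIV_unique[OF b ux[OF s]] .
    with eq have "a = ut s x"
      by (auto simp: ut_def)
    with a show ?thesis
      by simp
  qed
  have comp: "continuous_on B (\<lambda>p. g (a p) (b p))"
    if "continuous_on ({0..T} \<times> UNIV) (\<lambda>(t, x). g t x)" "continuous_on B a" "continuous_on B b"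
      "a ` B \<subseteq> {0..T}" for B :: "(real \<times> real) set" and a b and g :: "real \<Rightarrow> real \<Rightarrow> real"
    using continuous_on_compose2[OF that(1) continuous_on_Pair[OF that(2,3)]] that(4) by auto
  have slice: "continuous_on B (\<lambda>x. g s (b x))"
    if "continuous_on ({0..T} \<times> UNIV) (\<lambda>(t, x). g t x)" "continuous_on B b" "s \<in> {0..T}"
    for B :: "real set" and b s and g :: "real \<Rightarrow> real \<Rightarrow> real"
  proof -
    have "(\<lambda>x. (s, b x)) ` B \<subseteq> {0..T} \<times> UNIV"
      using that(3) by blast
    from continuous_on_compose2[OF that(1) continuous_on_Pair[OF continuous_on_const that(2)] this]
    show ?thesis
      by simp
  qed
  note conts = u_cont \<eta>_cont ux_cont

  define a where "a = integral {0..L} (\<lambda>x. \<bar>diff_x h u t x\<bar> * diff_x h ut t x)"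
  define b where "b = 1/2 * integral {0..L} (\<lambda>x. \<bar>diff_x h u t x\<bar> * diff_x h u t x * ux t (x + h))"

  have "((\<lambda>s. integral (cbox 0 L) (\<lambda>x. \<bar>diff_x h u s x\<bar> * diff_x h u s x)) has_real_derivative
      integral (cbox 0 L) (\<lambda>x. 2 * (\<bar>diff_x h u t x\<bar> * diff_x h ut t x))) (at t within {0..T})"
  proof (rule leibniz_rule_field_derivative)
    fix s x
    assume s: "s \<in> {0..T}"
    have "((\<lambda>s. diff_x h u s x) has_real_derivative diff_x h ut s x) (at s within {0..T})"
      unfolding diff_x_def by (intro DERIV_diff ut s)
    from DERIV_chain2[OF DERIV_abs_mult_self this]
    show "((\<lambda>s. \<bar>diff_x h u s x\<bar> * diff_x h u s x) has_real_derivative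
        2 * (\<bar>diff_x h u s x\<bar> * diff_x h ut s x)) (at s within {0..T})"
      by (simp add: mult.assoc)
  next
    fix s
    assume "s \<in> {0..T}"
    then show "(\<lambda>x. \<bar>diff_x h u s x\<bar> * diff_x h u s x) integrable_on cbox 0 L"
      unfolding diff_x_def by (intro integrable_continuous continuous_intros slice[OF u_cont])
  next
    show "continuous_on ({0..T} \<times> cbox 0 L) (\<lambda>(s, x). 2 * (\<bar>diff_x h u s x\<bar> * diff_x h ut s x))"
      unfolding diff_x_def ut_def case_prod_beta
      by (intro continuous_intros comp[OF u_cont] comp[OF \<eta>_cont] comp[OF ux_cont]) auto
  qed (use t in auto)
  from DERIV_cmult[OF this, of "1/2"]
  have da: "((\<lambda>s. 1/2 * integral {0..L} (\<lambda>x. \<bar>diff_x h u s x\<bar> * diff_x h u s x))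
      has_real_derivative a) (at t within {0..T})"
    by (simp add: a_def)

  have "((\<lambda>k. integral (cbox 0 L) (\<lambda>x. \<bar>diff_x k u t x\<bar> ^ 3)) has_real_derivative
      integral (cbox 0 L) (\<lambda>x. 3 * (\<bar>diff_x h u t x\<bar> * diff_x h u t x * ux t (x + h)))) (at h)"
  proof (rule leibniz_rule_field_derivative)
    fix k x :: real
    have "((\<lambda>k. u t (x + k)) has_real_derivative ux t (x + k)) (at k)"
      using ux[OF t, of "x + k"] DERIV_shift[of "u t" _ k x] by (simp add: add.commute)
    then have "((\<lambda>k. diff_x k u t x) has_real_derivative ux t (x + k)) (at k)"
      unfolding diff_x_def by (auto intro!: derivative_eq_intros)
    from DERIV_chain2[OF DERIV_abs_power3 this]
    show "((\<lambda>k. \<bar>diff_x k u t x\<bar> ^ 3) has_real_derivative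
        3 * (\<bar>diff_x k u t x\<bar> * diff_x k u t x * ux t (x + k))) (at k)"
      by (simp add: mult.assoc)
  next
    fix k :: real
    show "(\<lambda>x. \<bar>diff_x k u t x\<bar> ^ 3) integrable_on cbox 0 L"
      unfolding diff_x_def by (intro integrable_continuous continuous_intros slice[OF u_cont] t)
  next
    show "continuous_on (UNIV \<times> cbox 0 L)
        (\<lambda>(k, x). 3 * (\<bar>diff_x k u t x\<bar> * diff_x k u t x * ux t (x + k)))"
      unfolding diff_x_def case_prod_beta
      by (intro continuous_intros comp[OF u_cont] comp[OF ux_cont]) (use t in auto)
  qed auto
  from DERIV_cmult[OF this, of "1/6"]
  have db: "((\<lambda>k. 1/6 * integral {0..L} (\<lambda>x. \<bar>diff_x k u t x\<bar> ^ 3)) has_real_derivative b) (at h)"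
    by (simp add: b_def)

  have "(\<lambda>x. \<bar>diff_x h u t x\<bar> * diff_x h ut t x) integrable_on {0..L}"
    unfolding diff_x_def ut_def
    by (intro integrable_continuous_real continuous_intros conts[THEN slice] t)
  then have ia: "((\<lambda>x. \<bar>diff_x h u t x\<bar> * diff_x h ut t x) has_integral a) {0..L}"
    unfolding a_def by (rule integrable_integral)
  have "(\<lambda>x. \<bar>diff_x h u t x\<bar> * diff_x h u t x * ux t (x + h)) integrable_on {0..L}"
    unfolding diff_x_def
    by (intro integrable_continuous_real continuous_intros conts[THEN slice] t)
  then have ib: "((\<lambda>x. 1/2 * (\<bar>diff_x h u t x\<bar> * diff_x h u t x * ux t (x + h))) has_integral b) {0..L}"
    unfolding b_def by (intro has_integral_mult_right integrable_integral)
  have flux: "((\<lambda>x. \<bar>diff_x h u t x\<bar> * (u t (x + h) * ux t (x + h) - u t x * ux t x)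
      - 1/2 * (\<bar>diff_x h u t x\<bar> * diff_x h u t x) * ux t (x + h)) has_integral 0) {0..L}"
    unfolding diff_x_def
    by (rule increment_flux_integral_zero) (use assms(1,6) ux t in auto)
  \<comment> \<open>To be used with \<open>c = \<bar>w\<bar>\<close> and \<open>d = w\<close>: the cancellation is linear in \<open>c\<close>, and the relation
    between \<open>c\<close> and \<open>d\<close> has already been spent on making \<open>flux\<close> an exact derivative.\<close>
  have cancel: "c * diff_x h ut t x + 1/2 * (c * d * ux t (x + h))
      + (c * (u t (x + h) * ux t (x + h) - u t x * ux t x) - 1/2 * (c * d) * ux t (x + h))
      = diff_x h \<eta> t x * c" for c d x
    unfolding diff_x_def ut_def by (simp add: field_simps)
  have "((\<lambda>x. diff_x h \<eta> t x * \<bar>diff_x h u t x\<bar>) has_integral a + b + 0) {0..L}"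
    using has_integral_add[OF has_integral_add[OF ia ib] flux] unfolding cancel .
  then have "a + b = integral {0..L} (\<lambda>x. diff_x h \<eta> t x * \<bar>diff_x h u t x\<bar>)"
    by (simp add: integral_unique)
  with da db show "\<exists>a b.
      ((\<lambda>s. 1/2 * integral {0..L} (\<lambda>x. \<bar>diff_x h u s x\<bar> * diff_x h u s x))
         has_real_derivative a) (at t within {0..T}) \<and>
      ((\<lambda>k. 1/6 * integral {0..L} (\<lambda>x. \<bar>diff_x k u t x\<bar> ^ 3)) has_real_derivative b) (at h) \<and>
      a + b = integral {0..L} (\<lambda>x. diff_x h \<eta> t x * \<bar>diff_x h u t x\<bar>)"
    by blast
qed

end
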